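(* Let $P=\{p_1,\ldots,p_n\}$ be a finite poset and let $x,y\in P$ with $x<y$. Define $L_1=\{\alpha\in\mathcal{I}(P): \text{if } x\in\alpha \text{ then } y\in\alpha\}$, a sublattice of $\mathcal{I}(P)$. Let $P_1$ be the poset on the set $P\setminus\{p\in P:x\le p<y\}$ whose order is the one generated (i.e. the transitive closure) by the following relations, for $p,q\in P_1$: $p\le q$ in $P_1$ if either (1) $p\in P_1\setminus\{y\}$, $q\in P_1$ and $p\le q$ in $P$; or (2) $p=y$ and there is a $p'\in\{a\in P:x\le a\le y\}$ such that $p'\le q$ in $P$. Let $H$ be the semigroup generated by $\{h_\alpha:\alpha\in\mathcal{I}(P)\}$ and $H'$ the subsemigroup of $H$ generated by $\{h_\alpha:\alpha\in L_1\}$. Then $L_1\cong\mathcal{I}(P_1)$ (as lattices) and $H'$ is a homologically pure subsemigroup of $H$.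
   Context: $\mathcal{I}(P)$ is the distributive lattice of order ideals (down-closed subsets, including $\emptyset$ and $P$) of $P$, ordered by inclusion. For $\alpha\in\mathcal{I}(P)$, $h_\alpha\in\mathbb{N}^{n+1}$ is the vector whose first entry is $1$ and whose $(i+1)$-th entry is $1$ if $p_i\in\alpha$ and $0$ if $p_i\notin\alpha$ ($1\le i\le n$). Let $H\subset\mathbb{N}^m$ be an affine semigroup (containing $0$) with minimal generators $h_1,\ldots,h_s$. A subsemigroup $H'\subset H$ generated by a subset of $\{h_1,\ldots,h_s\}$ is called homologically pure if for all $h\in H'$ and all $h_i$ with $h-h_i\in H$, one has $h_i\in H'$. *)

theory Defs
  imports Main "Jordan_Normal_Form.Matrix"
begin

text \<open>A poset is a carrier \<open>P\<close> with a relation \<open>r\<close> such that \<open>partial_order_on P r\<close>;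
  \<open>(p, q) \<in> r\<close> reads \<open>p \<le> q\<close>.\<close>

definition order_ideals :: "'a set \<Rightarrow> 'a rel \<Rightarrow> 'a set set" where
  "order_ideals P r = {\<alpha>. \<alpha> \<subseteq> P \<and> (\<forall>q\<in>\<alpha>. \<forall>p\<in>P. (p, q) \<in> r \<longrightarrow> p \<in> \<alpha>)}"

text \<open>Order ideals are closed under intersection and union, so the meet and join of the lattice
  of order ideals are those of the ambient type \<open>'a set\<close>.  The next two notions are therefore
  stated for subsets of a lattice type, with the operations \<open>inf\<close> and \<open>sup\<close> of that type.\<close>

definition sublattice_of :: "'a::lattice set \<Rightarrow> 'a set \<Rightarrow> bool" where
  "sublattice_of A L \<longleftrightarrow> A \<subseteq> L \<and> (\<forall>a\<in>A. \<forall>b\<in>A. inf a b \<in> A \<and> sup a b \<in> A)"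

definition lattice_isomorphic :: "'a::lattice set \<Rightarrow> 'b::lattice set \<Rightarrow> bool" where
  "lattice_isomorphic A B \<longleftrightarrow>
     (\<exists>f. bij_betw f A B \<and>
          (\<forall>a\<in>A. \<forall>b\<in>A. f (inf a b) = inf (f a) (f b) \<and> f (sup a b) = sup (f a) (f b)))"

definition L1 :: "'a set \<Rightarrow> 'a rel \<Rightarrow> 'a \<Rightarrow> 'a \<Rightarrow> 'a set set" where
  "L1 P r x y = {\<alpha> \<in> order_ideals P r. x \<in> \<alpha> \<longrightarrow> y \<in> \<alpha>}"

definition P1 :: "'a set \<Rightarrow> 'a rel \<Rightarrow> 'a \<Rightarrow> 'a \<Rightarrow> 'a set" where
  "P1 P r x y = P - {p \<in> P. (x, p) \<in> r \<and> (p, y) \<in> r \<and> p \<noteq> y}"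

definition P1_order :: "'a set \<Rightarrow> 'a rel \<Rightarrow> 'a \<Rightarrow> 'a \<Rightarrow> 'a rel" where
  "P1_order P r x y =
     {(p, q). p \<in> P1 P r x y \<and> q \<in> P1 P r x y \<and>
        (p \<noteq> y \<and> (p, q) \<in> r \<or>
         p = y \<and> (\<exists>p'\<in>{a \<in> P. (x, a) \<in> r \<and> (a, y) \<in> r}. (p', q) \<in> r))}\<^sup>+"

text \<open>With \<open>P = {p 1, \<dots>, p n}\<close>.  Vector entries are indexed from \<open>0\<close>, so index \<open>i\<close> is the
  \<open>(i + 1)\<close>-th entry.\<close>

definition ideal_vec :: "nat \<Rightarrow> (nat \<Rightarrow> 'a) \<Rightarrow> 'a set \<Rightarrow> nat vec" where
  "ideal_vec n p \<alpha> = vec (n + 1) (\<lambda>i. if i = 0 then 1 else if p i \<in> \<alpha> then 1 else 0)"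

text \<open>The subsemigroup of \<open>\<nat>\<^sup>m\<close> (containing \<open>0\<close>) generated by \<open>S\<close>.\<close>

inductive_set semigroup_gen :: "nat \<Rightarrow> nat vec set \<Rightarrow> nat vec set"
  for m :: nat and S :: "nat vec set" where
  zero: "0\<^sub>v m \<in> semigroup_gen m S"
| add: "g \<in> S \<Longrightarrow> v \<in> semigroup_gen m S \<Longrightarrow> g + v \<in> semigroup_gen m S"

definition minimal_generators :: "nat \<Rightarrow> nat vec set \<Rightarrow> nat vec set \<Rightarrow> bool" where
  "minimal_generators m H G \<longleftrightarrow>
     finite G \<and> G \<subseteq> carrier_vec m \<and> H = semigroup_gen m G \<and>
     (\<forall>G'. G' \<subset> G \<longrightarrow> semigroup_gen m G' \<noteq> H)"

text \<open>An affine semigroup in \<open>\<nat>\<^sup>m\<close> has exactly one minimal generating set \<open>G\<close> (its nonzero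
  elements that are not sums of two nonzero elements), so the existential quantifier only names it.
  Since subtraction of natural numbers truncates, \<open>h - g \<in> H\<close> is written \<open>h = g + k\<close> with
  \<open>k \<in> H\<close>.\<close>

definition homologically_pure :: "nat \<Rightarrow> nat vec set \<Rightarrow> nat vec set \<Rightarrow> bool" where
  "homologically_pure m H H' \<longleftrightarrow>
     (\<exists>G. minimal_generators m H G \<and>
          (\<exists>S\<subseteq>G. H' = semigroup_gen m S) \<and>
          (\<forall>h\<in>H'. \<forall>g\<in>G. (\<exists>k\<in>H. h = g + k) \<longrightarrow> g \<in> H'))"

end

theory Submission
  imports Defs
begin

text \<open>The transitive closure defining \<open>P\<^sub>1\<close> has a closed form: \<open>p \<le>\<^sub>1 q\<close> iff \<open>p \<le> q\<close>, or \<open>p \<le> y\<close>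
  and \<open>x \<le> q\<close>; that is, the interval from \<open>x\<close> to \<open>y\<close> is collapsed to \<open>y\<close>. An ideal in \<open>L\<^sub>1\<close>
  contains all or nothing of this interval, so \<open>\<alpha> \<mapsto> \<alpha> \<inter> P\<^sub>1\<close> is an isomorphism. For purity,
  compare the entries at \<open>x\<close> and \<open>y\<close>: on \<open>H\<close> the entry at \<open>y\<close> is at most the one at \<open>x\<close>, on
  \<open>H'\<close> the two agree, and \<open>h\<^sub>\<alpha>\<close> with \<open>\<alpha> \<notin> L\<^sub>1\<close> has the entries \<open>0\<close> at \<open>y\<close> and \<open>1\<close> at \<open>x\<close>.\<close>

section \<open>The order of the collapsed poset\<close>

lemma P1_order_eq:
  assumes "partial_order_on P r" and "x \<in> P" "y \<in> P" "(x, y) \<in> r"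
  shows "P1_order P r x y =
    {(p, q). p \<in> P1 P r x y \<and> q \<in> P1 P r x y \<and> ((p, q) \<in> r \<or> (p, y) \<in> r \<and> (x, q) \<in> r)}"
    (is "_ = ?S")
proof -
  define R where "R = {(p, q). p \<in> P1 P r x y \<and> q \<in> P1 P r x y \<and>
        (p \<noteq> y \<and> (p, q) \<in> r \<or>
         p = y \<and> (\<exists>p'\<in>{a \<in> P. (x, a) \<in> r \<and> (a, y) \<in> r}. (p', q) \<in> r))}"
  have tr: "trans r" and rf: "refl_on P r"
    using assms(1) by (auto simp: partial_order_on_def preorder_on_def)
  have xx: "(x, x) \<in> r" and yy: "(y, y) \<in> r"
    using rf assms(2,3) by (auto dest: refl_onD)
  have yP1: "y \<in> P1 P r x y"
    using assms(3) by (simp add: P1_def)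
  \<comment> \<open>A generating step from \<open>y\<close> starts at some \<open>p'\<close> with
    \<open>x \<le> p'\<close>, so its end \<open>q\<close> satisfies
    \<open>x \<le> q\<close>.\<close>
  have "R \<subseteq> ?S"
    using yy by (auto simp: R_def dest: transD[OF tr])
  \<comment> \<open>A detour \<open>p \<le> y\<close>, \<open>x \<le> q\<close> absorbs a comparison
    at either end, and two successive detours merge into one.\<close>
  moreover have "trans ?S"
  proof (rule transI)
    fix a b c
    assume "(a, b) \<in> ?S" "(b, c) \<in> ?S"
    then show "(a, c) \<in> ?S"
      using transD[OF tr, of a b c] transD[OF tr, of a b y] transD[OF tr, of x b c] by auto
  qed
  ultimately have "R\<^sup>+ \<subseteq> ?S"
    using trancl_mono_subset[of R ?S] by (simp only: trancl_id)
  moreover have "?S \<subseteq> R\<^sup>+"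
  proof
    fix z
    assume "z \<in> ?S"
    then obtain p q where z: "z = (p, q)" and pq: "p \<in> P1 P r x y" "q \<in> P1 P r x y"
      and disj: "(p, q) \<in> r \<or> (p, y) \<in> r \<and> (x, q) \<in> r"
      by auto
    \<comment> \<open>The witness \<open>p'\<close> is \<open>x\<close> itself.\<close>
    have from_y: "(y, q) \<in> R" if "(x, q) \<in> r"
      using that xx assms(2,4) yP1 pq(2) by (auto simp: R_def)
    show "z \<in> R\<^sup>+"
    proof (cases "p = y")
      case True
      then have "(x, q) \<in> r"
        using disj transD[OF tr assms(4)] by blast
      then show ?thesis
        using from_y True z by auto
    next
      case False
      show ?thesis
      proof (cases "(p, q) \<in> r")
        case True
        then have "(p, q) \<in> R"
          using False pq by (simp add: R_def)
        then show ?thesis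
          using z by auto
      next
        case nle: False
        \<comment> \<open>The detour is a chain of two generating steps, from \<open>p\<close> to
          \<open>y\<close> and from \<open>y\<close> to \<open>q\<close>.\<close>
        have "(p, y) \<in> R"
          using disj nle False pq yP1 by (auto simp: R_def)
        moreover have "(y, q) \<in> R"
          using from_y disj nle by blast
        ultimately show ?thesis
          using z by (meson r_into_trancl trancl_into_trancl)
      qed
    qed
  qed
  ultimately show ?thesis
    by (simp add: P1_order_def R_def)
qed

text \<open>Antisymmetry is the only real issue: a cycle that uses a detour puts both elements
  between \<open>x\<close> and \<open>y\<close>, where \<open>y\<close> alone survives in
  \<open>P1\<close>.\<close>

lemma partial_order_on_P1:
  assumes "partial_order_on P r" and "x \<in> P" "y \<in> P" "(x, y) \<in> r"
  shows "partial_order_on (P1 P r x y) (P1_order P r x y)"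
proof -
  have tr: "trans r" and rf: "refl_on P r" and an: "antisym r"
    using assms(1) by (auto simp: partial_order_on_def preorder_on_def)
  have in_interval: "q = y" if "q \<in> P1 P r x y" "(x, q) \<in> r" "(q, y) \<in> r" for q
    using that by (auto simp: P1_def)
  have "refl_on (P1 P r x y) (P1_order P r x y)"
    unfolding P1_order_eq[OF assms] using rf by (simp add: refl_on_def P1_def)
  moreover have "P1_order P r x y \<subseteq> P1 P r x y \<times> P1 P r x y"
    unfolding P1_order_eq[OF assms] by auto
  moreover have "trans (P1_order P r x y)"
    by (simp add: P1_order_def)
  moreover have "antisym (P1_order P r x y)"
  proof (rule antisymI)
    fix a b
    assume "(a, b) \<in> P1_order P r x y" "(b, a) \<in> P1_order P r x y"
    then have ab: "a \<in> P1 P r x y" "b \<in> P1 P r x y"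
      and le: "(a, b) \<in> r \<or> (a, y) \<in> r \<and> (x, b) \<in> r" "(b, a) \<in> r \<or> (b, y) \<in> r \<and> (x, a) \<in> r"
      unfolding P1_order_eq[OF assms] by auto
    show "a = b"
    proof (cases "(a, b) \<in> r \<and> (b, a) \<in> r")
      case True
      then show ?thesis
        using antisymD[OF an] by blast
    next
      case False
      then have "(x, a) \<in> r" "(a, y) \<in> r" "(x, b) \<in> r" "(b, y) \<in> r"
        using le transD[OF tr] by blast+
      then show ?thesis
        using in_interval ab by metis
    qed
  qed
  ultimately show ?thesis
    by (simp add: partial_order_on_def preorder_on_def)
qed

section \<open>The isomorphism of lattices\<close>

lemma sublattice_of_L1: "sublattice_of (L1 P r x y) (order_ideals P r)"
  by (auto simp: sublattice_of_def L1_def order_ideals_def)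

text \<open>Intersecting with a fixed set commutes with unions and intersections, so only
  bijectivity needs work.\<close>

lemma lattice_isomorphic_L1:
  assumes "partial_order_on P r" and "x \<in> P" "y \<in> P" "(x, y) \<in> r" and "x \<noteq> y"
  shows "lattice_isomorphic (L1 P r x y) (order_ideals (P1 P r x y) (P1_order P r x y))"
proof -
  have tr: "trans r" and rf: "refl_on P r"
    using assms(1) by (auto simp: partial_order_on_def preorder_on_def)
  have xx: "(x, x) \<in> r" and yy: "(y, y) \<in> r"
    using rf assms(2,3) by (auto dest: refl_onD)
  define Q where "Q = P1 P r x y"
  define I where "I = {p \<in> P. (x, p) \<in> r \<and> (p, y) \<in> r \<and> p \<noteq> y}"
  have Q: "Q = P - I"
    by (simp add: Q_def I_def P1_def)
  \<comment> \<open>The inverse map: \<open>y\<close> decides whether the deleted elements are put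
    back.\<close>
  define g where "g \<beta> = \<beta> \<union> (if y \<in> \<beta> then I else {})" for \<beta>
  have ideals: "order_ideals Q (P1_order P r x y) =
      {\<beta>. \<beta> \<subseteq> Q \<and> (\<forall>q\<in>\<beta>. \<forall>p\<in>Q. (p, q) \<in> r \<or> (p, y) \<in> r \<and> (x, q) \<in> r \<longrightarrow> p \<in> \<beta>)}"
    unfolding order_ideals_def P1_order_eq[OF assms(1-4)] Q_def by blast
  have "bij_betw (\<lambda>\<alpha>. \<alpha> \<inter> Q) (L1 P r x y) (order_ideals Q (P1_order P r x y))"
  proof (rule bij_betw_byWitness[where f' = g])
    show "\<forall>\<alpha>\<in>L1 P r x y. g (\<alpha> \<inter> Q) = \<alpha>"
    proof
      fix \<alpha>
      assume "\<alpha> \<in> L1 P r x y"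
      then have sub: "\<alpha> \<subseteq> P" and down: "\<And>p q. q \<in> \<alpha> \<Longrightarrow> p \<in> P \<Longrightarrow> (p, q) \<in> r \<Longrightarrow> p \<in> \<alpha>"
        and xy: "x \<in> \<alpha> \<Longrightarrow> y \<in> \<alpha>"
        by (auto simp: L1_def order_ideals_def)
      have "I \<subseteq> \<alpha>" if "y \<in> \<alpha>"
        using down[OF that] by (auto simp: I_def)
      \<comment> \<open>Any element of \<open>I\<close> in \<open>\<alpha>\<close> would force
        \<open>x\<close>, and hence \<open>y\<close>, into \<open>\<alpha>\<close>.\<close>
      moreover have "\<alpha> \<inter> I = {}" if "y \<notin> \<alpha>"
        using down[of _ x] xy assms(2) that unfolding I_def by blast
      moreover have "y \<in> Q"
        using assms(3) by (simp add: Q I_def)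
      ultimately show "g (\<alpha> \<inter> Q) = \<alpha>"
        using sub by (auto simp: g_def Q)
    qed
    show "\<forall>\<beta>\<in>order_ideals Q (P1_order P r x y). g \<beta> \<inter> Q = \<beta>"
      by (auto simp: g_def Q order_ideals_def split: if_splits)
    show "(\<lambda>\<alpha>. \<alpha> \<inter> Q) ` L1 P r x y \<subseteq> order_ideals Q (P1_order P r x y)"
    proof (rule image_subsetI)
      fix \<alpha>
      assume "\<alpha> \<in> L1 P r x y"
      then have "\<alpha> \<subseteq> P" and down: "\<And>p q. q \<in> \<alpha> \<Longrightarrow> p \<in> P \<Longrightarrow> (p, q) \<in> r \<Longrightarrow> p \<in> \<alpha>"
        and xy: "x \<in> \<alpha> \<Longrightarrow> y \<in> \<alpha>"
        by (auto simp: L1_def order_ideals_def)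
      \<comment> \<open>For a detour, \<open>x \<le> q\<close> gives first
        \<open>x \<in> \<alpha>\<close>, then \<open>y \<in> \<alpha>\<close>, and
        \<open>p \<le> y\<close> gives \<open>p \<in> \<alpha>\<close>.\<close>
      then show "\<alpha> \<inter> Q \<in> order_ideals Q (P1_order P r x y)"
        unfolding ideals using assms(2) Q by blast
    qed
    show "g ` order_ideals Q (P1_order P r x y) \<subseteq> L1 P r x y"
    proof (rule image_subsetI)
      fix \<beta>
      assume "\<beta> \<in> order_ideals Q (P1_order P r x y)"
      then have sub: "\<beta> \<subseteq> Q" and down: "\<And>p q. q \<in> \<beta> \<Longrightarrow> p \<in> Q \<Longrightarrow>
          (p, q) \<in> r \<or> (p, y) \<in> r \<and> (x, q) \<in> r \<Longrightarrow> p \<in> \<beta>"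
        unfolding ideals by blast+
      have yQ: "y \<in> Q" and xI: "x \<in> I"
        using assms xx by (auto simp: Q I_def)
      have "p \<in> g \<beta>" if "q \<in> g \<beta>" "p \<in> P" "(p, q) \<in> r" for p q
      proof (cases "q \<in> \<beta>")
        case True
        show ?thesis
        proof (cases "p \<in> Q")
          case True
          then show ?thesis
            using down[OF \<open>q \<in> \<beta>\<close>] that by (simp add: g_def)
        next
          case False
          then have "p \<in> I"
            using that Q by auto
          \<comment> \<open>A deleted \<open>p\<close> below \<open>q\<close> yields
            \<open>x \<le> q\<close>, so \<open>y\<close> is below \<open>q\<close> in the new order
            and lies in \<open>\<beta>\<close>.\<close>
          then have "(x, q) \<in> r"
            using transD[OF tr _ that(3)] by (simp add: I_def)
          then have "y \<in> \<beta>"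
            using down \<open>q \<in> \<beta>\<close> yQ yy by blast
          then show ?thesis
            using \<open>p \<in> I\<close> by (simp add: g_def)
        qed
      next
        case False
        then have "y \<in> \<beta>" "q \<in> I"
          using that(1) by (auto simp: g_def split: if_splits)
        then have "(p, y) \<in> r"
          using transD[OF tr that(3)] by (simp add: I_def)
        then show ?thesis
          using down[OF \<open>y \<in> \<beta>\<close>, of p] \<open>y \<in> \<beta>\<close> that(2) Q by (auto simp: g_def)
      qed
      moreover have "g \<beta> \<subseteq> P"
        using sub by (auto simp: g_def Q I_def)
      \<comment> \<open>As \<open>x\<close> is deleted from \<open>Q\<close>, only the part added
        because of \<open>y \<in> \<beta>\<close> can contain it.\<close>
      moreover have "y \<in> g \<beta>" if "x \<in> g \<beta>"
        using that xI sub by (auto simp: g_def Q split: if_splits)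
      ultimately show "g \<beta> \<in> L1 P r x y"
        by (auto simp: L1_def order_ideals_def)
    qed
  qed
  then show ?thesis
    unfolding lattice_isomorphic_def Q_def
    by (intro exI[of _ "\<lambda>\<alpha>. \<alpha> \<inter> P1 P r x y"]) auto
qed

section \<open>Semigroups generated by ideal vectors\<close>

lemma ideal_vec_carrier: "ideal_vec n p \<alpha> \<in> carrier_vec (n + 1)"
  by (simp add: ideal_vec_def)

lemma ideal_vec_0: "ideal_vec n p \<alpha> $ 0 = 1"
  by (simp add: ideal_vec_def)

lemma ideal_vec_nth: "1 \<le> i \<Longrightarrow> i \<le> n \<Longrightarrow> ideal_vec n p \<alpha> $ i = (if p i \<in> \<alpha> then 1 else 0)"
  by (simp add: ideal_vec_def)

lemma semigroup_gen_carrier: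
  assumes "v \<in> semigroup_gen m S" and "S \<subseteq> carrier_vec m"
  shows "v \<in> carrier_vec m"
  using assms by (induction rule: semigroup_gen.induct) auto

lemma generator_in_semigroup_gen:
  assumes "g \<in> S" and "S \<subseteq> carrier_vec m"
  shows "g \<in> semigroup_gen m S"
  using semigroup_gen.add[OF assms(1) semigroup_gen.zero[of m S]] assms by auto

text \<open>Adding vectors preserves an inequality between two entries, so it suffices to check
  generators.\<close>

lemma semigroup_gen_entry_le:
  assumes "v \<in> semigroup_gen m S" and "S \<subseteq> carrier_vec m" and "i < m" "j < m"
    and "\<And>g. g \<in> S \<Longrightarrow> g $ i \<le> g $ j"
  shows "v $ i \<le> v $ j"
  using assms(1)
proof (induction rule: semigroup_gen.induct)
  case zero
  then show ?case
    using assms by simp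
next
  case (add g v)
  have "v \<in> carrier_vec m"
    using semigroup_gen_carrier[OF add.hyps(2) assms(2)] .
  then show ?case
    using add assms by (auto intro: add_mono)
qed

text \<open>Entry \<open>i\<close> is a degree counting the summands, so a generator, having degree
  1, is not a sum of other generators.\<close>

lemma minimal_generators_if_entry_1:
  assumes "finite G" and "G \<subseteq> carrier_vec m" and "i < m" and one: "\<And>g. g \<in> G \<Longrightarrow> g $ i = 1"
  shows "minimal_generators m (semigroup_gen m G) G"
proof -
  \<comment> \<open>The claim on degree 0 carries the induction: if \<open>g + v\<close> has degree
    1, then \<open>v\<close> has degree 0 and vanishes.\<close>
  have irreducible: "(v $ i = 0 \<longrightarrow> v = 0\<^sub>v m) \<and> (v $ i = 1 \<longrightarrow> v \<in> S)"
    if "v \<in> semigroup_gen m S" "S \<subseteq> G" for v S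
    using that(1)
  proof (induction rule: semigroup_gen.induct)
    case zero
    then show ?case
      using assms(3) by simp
  next
    case (add g v)
    have "v \<in> carrier_vec m"
      using semigroup_gen_carrier[OF add.hyps(2)] that(2) assms(2) by blast
    moreover have "g \<in> carrier_vec m" "g $ i = 1"
      using add.hyps(1) that(2) assms(2) one by auto
    ultimately show ?case
      using add assms(3) by auto
  qed
  have "semigroup_gen m G' \<noteq> semigroup_gen m G" if "G' \<subset> G" for G'
  proof
    assume eq: "semigroup_gen m G' = semigroup_gen m G"
    obtain g where g: "g \<in> G" "g \<notin> G'"
      using \<open>G' \<subset> G\<close> by blast
    then have "g \<in> semigroup_gen m G'"
      using eq generator_in_semigroup_gen assms(2) by blast
    then show False
      using irreducible[of g G'] that g one by auto
  qed
  then show ?thesis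
    using assms by (auto simp: minimal_generators_def)
qed

lemma homologically_pure_L1:
  assumes "bij_betw p {1..n} P" and "x \<in> P" "y \<in> P" "(x, y) \<in> r"
  shows "homologically_pure (n + 1) (semigroup_gen (n + 1) (ideal_vec n p ` order_ideals P r))
           (semigroup_gen (n + 1) (ideal_vec n p ` L1 P r x y))"
    (is "homologically_pure _ (semigroup_gen _ ?G) (semigroup_gen _ ?S)")
proof -
  have GC: "?G \<subseteq> carrier_vec (n + 1)" and SC: "?S \<subseteq> carrier_vec (n + 1)"
    using ideal_vec_carrier by blast+
  have "finite P"
    using assms(1) bij_betw_finite by blast
  then have "finite (order_ideals P r)"
    by (rule finite_subset[rotated, OF finite_Pow_iff[THEN iffD2]]) (auto simp: order_ideals_def)
  then have "finite ?G"
    by (rule finite_imageI)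
  \<comment> \<open>The constant first entry of the ideal vectors serves as the degree.\<close>
  then have min: "minimal_generators (n + 1) (semigroup_gen (n + 1) ?G) ?G"
    by (rule minimal_generators_if_entry_1[OF _ GC, of 0]) (auto simp: ideal_vec_0)
  have sub: "?S \<subseteq> ?G"
    by (auto simp: L1_def)
  obtain i j where ij: "1 \<le> i" "i \<le> n" "p i = x" "1 \<le> j" "j \<le> n" "p j = y"
    using assms(2,3) unfolding bij_betw_imp_surj_on[OF assms(1), symmetric] by auto
  have pure: "g \<in> semigroup_gen (n + 1) ?S"
    if h: "g + k \<in> semigroup_gen (n + 1) ?S" and "g \<in> ?G"
      and k: "k \<in> semigroup_gen (n + 1) ?G" for g k
  proof -
    obtain \<alpha> where \<alpha>: "\<alpha> \<in> order_ideals P r" "g = ideal_vec n p \<alpha>"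
      using \<open>g \<in> ?G\<close> by blast
    have "k $ j \<le> k $ i"
      using assms(2,4) ij
      by (intro semigroup_gen_entry_le[OF k GC]) (auto simp: ideal_vec_nth order_ideals_def)
    moreover have "(g + k) $ i \<le> (g + k) $ j"
      using ij by (intro semigroup_gen_entry_le[OF h SC]) (auto simp: ideal_vec_nth L1_def)
    moreover have "k \<in> carrier_vec (n + 1)"
      using semigroup_gen_carrier[OF k GC] .
    \<comment> \<open>The opposite inequality for \<open>k\<close> cancels its contribution to the
      sum.\<close>
    ultimately have "g $ i \<le> g $ j"
      using ij \<alpha> by auto
    \<comment> \<open>For entries 0 and 1, the inequality is the implication from
      \<open>x \<in> \<alpha>\<close> to \<open>y \<in> \<alpha>\<close>.\<close>
    then have "\<alpha> \<in> L1 P r x y"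
      using \<alpha> ij by (auto simp: ideal_vec_nth L1_def split: if_splits)
    then show ?thesis
      using generator_in_semigroup_gen SC \<alpha> by blast
  qed
  show ?thesis
    unfolding homologically_pure_def using min sub pure by blast
qed

theorem lemma3p6:
  fixes P :: "'a set" and r :: "'a rel" and n :: nat and p :: "nat \<Rightarrow> 'a" and x y :: 'a
    and H H' :: "nat vec set"
  assumes "partial_order_on P r"
    and "bij_betw p {1..n} P"
    and "x \<in> P" and "y \<in> P" and "(x, y) \<in> r" and "x \<noteq> y"
    and "H = semigroup_gen (n + 1) (ideal_vec n p ` order_ideals P r)"
    and "H' = semigroup_gen (n + 1) (ideal_vec n p ` L1 P r x y)"
  shows "sublattice_of (L1 P r x y) (order_ideals P r)
    \<and> partial_order_on (P1 P r x y) (P1_order P r x y)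
    \<and> lattice_isomorphic (L1 P r x y) (order_ideals (P1 P r x y) (P1_order P r x y))
    \<and> homologically_pure (n + 1) H H'"
  unfolding assms(7,8)
  using sublattice_of_L1 partial_order_on_P1[OF assms(1,3-5)] lattice_isomorphic_L1[OF assms(1,3-6)]
    homologically_pure_L1[OF assms(2-5)]
  by (intro conjI)

end
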